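(* Let $L$ be the first order system operator with characteristic function $F(z)=\sum_{r=1}^R\delta_r e^{z\overline{\gamma_r}}$ described in the context, and assume the generic case described there. Given $0<\varepsilon<1/9$ there exists $T_\varepsilon$ such that any eigenvalue $z$ of $L$ satisfying $|z|>T_\varepsilon$ must lie in $S_r^\varepsilon$ for some $r$ such that $1\le r\le Q$.
   Context: Operator. Let $\alpha=\alpha_0<\alpha_1<\dots<\alpha_m=\beta$ be real, let $A_1,\dots,A_m$ be invertible diagonalizable complex $n\times n$ matrices, and put $A(x)=A_s$ for $\alpha_{s-1}<x\le\alpha_s$. Let $S,T$ be complex $n\times n$ matrices. $L$ acts in $L^2((\alpha,\beta),\mathbb{C}^n)$ by $(Lf)(x)=A(x)f'(x)$ on the domain of all $f\in W^{1,2}((\alpha,\beta),\mathbb{C}^n)$ with $Sf(\alpha)+Tf(\beta)=0$. Put $U(z,\beta)=U_m U_{m-1}\cdots U_1$ with $U_s=e^{zA_s^{-1}(\alpha_s-\alpha_{s-1})}$, and $F(z)=\det(S+T\,U(z,\beta))$; $z$ is an eigenvalue of $L$ iff $F(z)=0$. $F$ is an exponential sum $F(z)=\sum_{r=1}^R\delta_r e^{z\overline{\gamma_r}}$, written so that the $\gamma_r\in\mathbb{C}$ are all different and all $\delta_r\in\mathbb{C}$ are non-zero; it is assumed that $R\ge2$. Notation. For $z,w\in\mathbb{C}$, $z\cdot w=\mathrm{Re}(z\overline{w})$. $K$ is the convex hull of $\{\gamma_1,\dots,\gamma_R\}$. Generic case: the $\gamma_r$ are labelled so that $\gamma_1,\dots,\gamma_Q$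 are the vertices of $K$ in anticlockwise order, and the remaining $\gamma_r$ lie in the interior of $K$ (no $\gamma_r$ lies on an edge of $K$ unless it is a vertex of $K$). If $K$ is a segment then $Q=R=2$ and the segment is regarded as having two edges, one for each $r$. For $1\le r\le Q$, $r_-=r-1$ if $r\ge2$ and $1_-=Q$. For $1\le r\le Q$ let $k_r=\log|\delta_{r_-}/\delta_r|$, so that $|\delta_r e^{z\overline{\gamma_r}}|=|\delta_{r_-}e^{z\overline{\gamma_{r_-}}}|$ iff $z\cdot(\gamma_r-\gamma_{r_-})=k_r$. Let $e_r$ be the outward pointing unit normal to the edge $(\gamma_{r_-},\gamma_r)$ of $K$, i.e. $e_r=-i(\gamma_r-\gamma_{r_-})/|\gamma_r-\gamma_{r_-}|$. Define $$S_r^\varepsilon=\{z\in\mathbb{C}: z\cdot e_r\ge\gamma_r\cdot e_r\ \text{and}\ k_r-\varepsilon\le z\cdot(\gamma_r-\gamma_{r_-})\le k_r+\varepsilon\}.$$ *)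

theory Defs
  imports "HOL-Analysis.Analysis"
begin

section \<open>Matrices\<close>

text \<open>The multiplication of the type class on \<open>_ ^ 'n\<close> is componentwise, so neither the library
  \<open>exp\<close> nor \<open>(^)\<close> is the matrix operation; powers are iterated \<open>(**)\<close>.\<close>

definition matrix_exp :: "complex^'n^'n \<Rightarrow> complex^'n^'n" where
  "matrix_exp M = (\<Sum>k. (1 / fact k) *\<^sub>R (((**) M) ^^ k) (mat 1))"

definition diagonalizable :: "complex^'n^'n \<Rightarrow> bool" where
  "diagonalizable M \<longleftrightarrow>
     (\<exists>(P :: complex^'n^'n) (D :: complex^'n^'n).
        invertible P \<and> (\<forall>i j. i \<noteq> j \<longrightarrow> D $ i $ j = 0) \<and> M = P ** D ** matrix_inv P)"


section \<open>The Sobolev space\<close>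

definition L2_on :: "real \<Rightarrow> real \<Rightarrow> (real \<Rightarrow> complex^'n) \<Rightarrow> bool" where
  "L2_on a b g \<longleftrightarrow> set_borel_measurable lebesgue {a<..<b} g \<and>
     set_integrable lebesgue {a<..<b} (\<lambda>x. (norm (g x))\<^sup>2)"

text \<open>An element of \<open>W\<^sup>1\<^sup>,\<^sup>2(a,b)\<close> is represented by its continuous representative on the closed
  interval, so that its boundary values make sense: \<open>f\<close> is absolutely continuous on \<open>[a,b]\<close>, i.e.
  the indefinite Lebesgue integral of its derivative \<open>g\<close>, and \<open>g\<close> is square integrable. As \<open>g\<close> is
  determined only almost everywhere, the derivative is a relation. Square integrability of \<open>f\<close>
  itself is automatic on a bounded interval.\<close>

definition W12_deriv :: "real \<Rightarrow> real \<Rightarrow> (real \<Rightarrow> complex^'n) \<Rightarrow> (real \<Rightarrow> complex^'n) \<Rightarrow> bool" where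
  "W12_deriv a b f g \<longleftrightarrow> L2_on a b g \<and>
     (\<forall>x\<in>{a..b}. f x = f a + set_lebesgue_integral lebesgue {a..x} g)"


section \<open>The operator\<close>

definition coeff_fun ::
    "nat \<Rightarrow> (nat \<Rightarrow> real) \<Rightarrow> (nat \<Rightarrow> complex^'n^'n) \<Rightarrow> real \<Rightarrow> complex^'n^'n" where
  "coeff_fun m \<alpha> A x = A (THE s. s \<in> {1..m} \<and> \<alpha> (s - 1) < x \<and> x \<le> \<alpha> s)"

text \<open>The graph of \<open>L\<close>: the pairs \<open>(f, h)\<close> with \<open>f\<close> in the domain and \<open>L f = h\<close> as elements
  of \<open>L\<^sup>2\<close>.\<close>

definition system_op ::
    "nat \<Rightarrow> (nat \<Rightarrow> real) \<Rightarrow> (nat \<Rightarrow> complex^'n^'n) \<Rightarrow> complex^'n^'n \<Rightarrow> complex^'n^'n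
      \<Rightarrow> ((real \<Rightarrow> complex^'n) \<times> (real \<Rightarrow> complex^'n)) set" where
  "system_op m \<alpha> A S T = {(f, h). \<exists>f'. W12_deriv (\<alpha> 0) (\<alpha> m) f f' \<and>
     S *v f (\<alpha> 0) + T *v f (\<alpha> m) = 0 \<and>
     (AE x\<in>{\<alpha> 0<..<\<alpha> m} in lebesgue. h x = coeff_fun m \<alpha> A x *v f' x)}"

definition eigenvalue_of ::
    "nat \<Rightarrow> (nat \<Rightarrow> real) \<Rightarrow> (nat \<Rightarrow> complex^'n^'n) \<Rightarrow> complex^'n^'n \<Rightarrow> complex^'n^'n
      \<Rightarrow> complex \<Rightarrow> bool" where
  "eigenvalue_of m \<alpha> A S T z \<longleftrightarrow>
     (\<exists>f. (f, \<lambda>x. z *s f x) \<in> system_op m \<alpha> A S T \<and>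
          \<not> (AE x\<in>{\<alpha> 0<..<\<alpha> m} in lebesgue. f x = 0))"

fun transfer_matrix ::
    "(nat \<Rightarrow> real) \<Rightarrow> (nat \<Rightarrow> complex^'n^'n) \<Rightarrow> complex \<Rightarrow> nat \<Rightarrow> complex^'n^'n" where
  "transfer_matrix \<alpha> A z 0 = mat 1"
| "transfer_matrix \<alpha> A z (Suc s) =
     matrix_exp (map_matrix (\<lambda>c. z * c * complex_of_real (\<alpha> (Suc s) - \<alpha> s))
       (matrix_inv (A (Suc s)))) ** transfer_matrix \<alpha> A z s"

definition char_fun ::
    "nat \<Rightarrow> (nat \<Rightarrow> real) \<Rightarrow> (nat \<Rightarrow> complex^'n^'n) \<Rightarrow> complex^'n^'n \<Rightarrow> complex^'n^'n
      \<Rightarrow> complex \<Rightarrow> complex" where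
  "char_fun m \<alpha> A S T z = det (S + T ** transfer_matrix \<alpha> A z m)"


section \<open>The generic case\<close>

text \<open>\<open>\<gamma> 1, \<dots>, \<gamma> Q\<close> are listed anticlockwise: seen from some point \<open>p\<close> inside the convex set \<open>K\<close>, their
  arguments increase and go round at most once. The relative interior is used so that the
  condition is meaningful (and then no restriction) for the two end points of a segment.\<close>

definition anticlockwise :: "complex set \<Rightarrow> nat \<Rightarrow> (nat \<Rightarrow> complex) \<Rightarrow> bool" where
  "anticlockwise K Q \<gamma> \<longleftrightarrow>
     (\<exists>p \<in> rel_interior K. \<exists>\<theta> :: nat \<Rightarrow> real.
        strict_mono_on {1..Q} \<theta> \<and> \<theta> Q < \<theta> 1 + 2 * pi \<and>
        (\<forall>r\<in>{1..Q}. \<gamma> r - p = complex_of_real (cmod (\<gamma> r - p)) * cis (\<theta> r)))"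

text \<open>If \<open>K\<close> is a segment its interior in the plane is empty, so the last condition forces
  \<open>R = Q = 2\<close>. In all cases it excludes points on an edge other than the vertices.\<close>

definition generic_case :: "nat \<Rightarrow> nat \<Rightarrow> (nat \<Rightarrow> complex) \<Rightarrow> bool" where
  "generic_case R Q \<gamma> \<longleftrightarrow>
     (let K = convex hull (\<gamma> ` {1..R}) in
        1 \<le> Q \<and> Q \<le> R \<and>
        \<gamma> ` {1..Q} = {v. v extreme_point_of K} \<and>
        anticlockwise K Q \<gamma> \<and>
        \<gamma> ` {Q<..R} \<subseteq> interior K)"


section \<open>The strips\<close>

definition prev_index :: "nat \<Rightarrow> nat \<Rightarrow> nat" where
  "prev_index Q r = (if r = 1 then Q else r - 1)"

definition k_const :: "nat \<Rightarrow> (nat \<Rightarrow> complex) \<Rightarrow> nat \<Rightarrow> real" where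
  "k_const Q \<delta> r = ln (cmod (\<delta> (prev_index Q r) / \<delta> r))"

definition edge_normal :: "nat \<Rightarrow> (nat \<Rightarrow> complex) \<Rightarrow> nat \<Rightarrow> complex" where
  "edge_normal Q \<gamma> r =
     - \<i> * (\<gamma> r - \<gamma> (prev_index Q r)) / complex_of_real (cmod (\<gamma> r - \<gamma> (prev_index Q r)))"

text \<open>On \<open>complex\<close> the library inner product \<open>z \<bullet> w\<close> is \<open>Re z * Re w + Im z * Im w = Re (z * cnj w)\<close>.\<close>

definition strip ::
    "nat \<Rightarrow> (nat \<Rightarrow> complex) \<Rightarrow> (nat \<Rightarrow> complex) \<Rightarrow> real \<Rightarrow> nat \<Rightarrow> complex set" where
  "strip Q \<gamma> \<delta> \<epsilon> r =
     {z. z \<bullet> edge_normal Q \<gamma> r \<ge> \<gamma> r \<bullet> edge_normal Q \<gamma> r \<and>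
         k_const Q \<delta> r - \<epsilon> \<le> z \<bullet> (\<gamma> r - \<gamma> (prev_index Q r)) \<and>
         z \<bullet> (\<gamma> r - \<gamma> (prev_index Q r)) \<le> k_const Q \<delta> r + \<epsilon>}"

end

theory Submission
  imports Defs
begin

text \<open>An eigenfunction solves \<open>f' = z A\<^sub>s\<^sup>-\<^sup>1 f\<close> on each piece, so \<open>f(\<beta>) = U(z,\<beta>) f(\<alpha>)\<close> with
  \<open>f(\<alpha>) \<noteq> 0\<close>, and the boundary condition says that \<open>f(\<alpha>)\<close> lies in the kernel of \<open>S + T U(z,\<beta>)\<close>;
  hence \<open>F(z) = 0\<close> (\<open>eigenvalue_of_imp_char_fun_zero\<close>). The Sobolev formulation costs
  a little regularity theory: since \<open>f\<close> is the integral of its derivative, the equation makes the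
  derivative continuous on each piece, and Taylor's formula then produces the matrix exponential
  series, which gives existence of the exponential and uniqueness of the solution in one step.

  For the location of the zeros of \<open>F\<close>, note \<open>\<bar>\<delta>\<^sub>r e\<^bsup>z cnj \<gamma>\<^sub>r\<^esup>\<bar> = \<bar>\<delta>\<^sub>r\<bar> e\<^bsup>z \<bullet> \<gamma>\<^sub>r\<^esup>\<close>. If the claim failed there
  would be zeros \<open>z\<^sub>n\<close> outside all strips with \<open>\<bar>z\<^sub>n\<bar> \<rightarrow> \<infinity>\<close>, and after passing to a subsequence
  \<open>z\<^sub>n / \<bar>z\<^sub>n\<bar> \<rightarrow> u\<close>. The terms whose \<open>\<gamma>\<^sub>r\<close> does not maximise \<open>u \<bullet> \<gamma>\<^sub>r\<close> are eventually negligible against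
  those that do (\<open>eventually_rest_dominated\<close>). By convexity and the generic hypothesis
  the maximisers are either a single vertex of \<open>K\<close>, or two consecutive vertices \<open>\<gamma>\<^sub>r\<^sub>-, \<gamma>\<^sub>r\<close> that span the
  edge with outward normal \<open>e\<^sub>r = u\<close> (\<open>generic_support_face\<close>). One dominant term cannot be
  cancelled. Two dominant terms can cancel only if their moduli agree up to a factor \<open>e\<^bsup>\<epsilon>\<^esup>\<close>, which is
  the second condition defining \<open>S\<^sub>r\<^sup>\<epsilon>\<close> (\<open>two_term_zero_in_strip\<close>), while \<open>z\<^sub>n \<bullet> e\<^sub>r \<rightarrow> \<infinity>\<close>
  gives the first; so \<open>z\<^sub>n\<close> would be in \<open>S\<^sub>r\<^sup>\<epsilon>\<close> after all.\<close>


section \<open>Constant coefficient systems and the matrix exponential\<close>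

lemma norm_funpow_le:
  fixes L :: "'a::real_normed_vector \<Rightarrow> 'a"
  assumes L: "bounded_linear L"
  shows "norm ((L ^^ k) y) \<le> onorm L ^ k * norm y"
proof (induction k)
  case (Suc k)
  have "norm ((L ^^ Suc k) y) \<le> onorm L * norm ((L ^^ k) y)"
    using onorm[OF L] by simp
  also have "\<dots> \<le> onorm L * (onorm L ^ k * norm y)"
    by (rule mult_left_mono[OF Suc onorm_pos_le[OF L]])
  finally show ?case by (simp add: mult.assoc)
qed simp

text \<open>Differentiating the equation shows that the \<open>k\<close>th derivative of \<open>f\<close> is \<open>L\<^sup>k f\<close>. So the series is
  the Taylor series of \<open>f\<close> at \<open>a\<close>, and the remainder after \<open>p\<close> steps is of order
  \<open>(onorm L (b - a))\<^sup>p / p!\<close>. As \<open>f\<close> is given, this is a uniqueness theorem that needs no differentiation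
  of the exponential series.\<close>

lemma linear_ode_sums:
  fixes L :: "'a::banach \<Rightarrow> 'a"
  assumes L: "bounded_linear L" and "a \<le> b"
    and der: "\<And>x. x \<in> {a..b} \<Longrightarrow> (f has_vector_derivative L (f x)) (at x within {a..b})"
  shows "(\<lambda>k. ((b - a) ^ k / fact k) *\<^sub>R (L ^^ k) (f a)) sums f b"
proof -
  have blk: "bounded_linear (L ^^ k)" for k
    by (induction k) (use L in \<open>auto simp: id_def comp_def intro: bounded_linear_compose\<close>)
  define C where "C = onorm L"
  have C0: "C \<ge> 0" unfolding C_def by (rule onorm_pos_le[OF L])
  have nk: "norm ((L ^^ k) y) \<le> C ^ k * norm y" for k y
    unfolding C_def by (rule norm_funpow_le[OF L])
  have "continuous_on {a..b} f"
    using der by (meson continuous_on_vector_derivative)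
  then have "bounded (f ` {a..b})"
    by (simp add: compact_continuous_image compact_imp_bounded)
  then obtain B where B: "\<forall>x\<in>{a..b}. norm (f x) \<le> B" and "B > 0"
    unfolding bounded_pos by auto
  define S where "S n = (\<Sum>k<n. ((b - a) ^ k / fact k) *\<^sub>R (L ^^ k) (f a))" for n
  have bound: "norm (f b - (\<Sum>k<Suc p. ((b - a) ^ k / fact k) *\<^sub>R (L ^^ k) (f a)))
      \<le> B * C * (b - a) * ((C * (b - a)) ^ p / fact p)" for p
  proof -
    have "((\<lambda>x. ((b - x) ^ (Suc p - 1) / fact (Suc p - 1)) *\<^sub>R (L ^^ Suc p) (f x)) has_integral
        f b - (\<Sum>k<Suc p. ((b - a) ^ k / fact k) *\<^sub>R (L ^^ k) (f a))) {a..b}"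
    proof (rule Taylor_has_integral[where Df = "\<lambda>k x. (L ^^ k) (f x)"])
      show "((\<lambda>x. (L ^^ k) (f x)) has_vector_derivative (L ^^ Suc k) (f x)) (at x within {a..b})"
        if "k < Suc p" "a \<le> x" "x \<le> b" for k x
        using bounded_linear.has_vector_derivative[OF blk[of k] der[of x]] that
        by (simp add: funpow_swap1)
    qed (use \<open>a \<le> b\<close> in auto)
    then have "norm (f b - (\<Sum>k<Suc p. ((b - a) ^ k / fact k) *\<^sub>R (L ^^ k) (f a)))
        \<le> ((b - a) ^ p / fact p * (C ^ Suc p * B)) * measure lborel (cbox a b)"
    proof (intro has_integral_bound)
      fix x assume x: "x \<in> cbox a b"
      have "norm ((L ^^ Suc p) (f x)) \<le> C ^ Suc p * B"
        by (rule order_trans[OF nk]) (use x B C0 in \<open>auto intro!: mult_left_mono\<close>)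
      moreover have "(b - x) ^ p / fact p \<le> (b - a) ^ p / fact p"
        using x by (intro divide_right_mono power_mono) auto
      ultimately have "((b - x) ^ p / fact p) * norm ((L ^^ Suc p) (f x))
          \<le> ((b - a) ^ p / fact p) * (C ^ Suc p * B)"
        using x \<open>a \<le> b\<close> by (intro mult_mono) auto
      then show "norm (((b - x) ^ (Suc p - 1) / fact (Suc p - 1)) *\<^sub>R (L ^^ Suc p) (f x))
          \<le> (b - a) ^ p / fact p * (C ^ Suc p * B)"
        using x by (simp add: power_abs)
    qed (use C0 \<open>B > 0\<close> \<open>a \<le> b\<close> in \<open>auto simp: cbox_interval\<close>)
    also have "\<dots> = B * C * (b - a) * ((C * (b - a)) ^ p / fact p)"
      using \<open>a \<le> b\<close> by (simp add: power_mult_distrib)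
    finally show ?thesis .
  qed
  have "(\<lambda>p. B * C * (b - a) * ((C * (b - a)) ^ p / fact p)) \<longlonglongrightarrow> B * C * (b - a) * 0"
    using summable_LIMSEQ_zero[OF summable_exp_generic[of "C * (b - a)"]]
    by (intro tendsto_mult_left) (simp add: divide_inverse mult.commute)
  then have "(\<lambda>p. f b - S (Suc p)) \<longlonglongrightarrow> 0"
    unfolding S_def by (intro Lim_null_comparison[OF always_eventually, OF allI, OF bound]) simp
  from tendsto_diff[OF tendsto_const[of "f b"] this] have "(\<lambda>p. S (Suc p)) \<longlonglongrightarrow> f b"
    by simp
  then show ?thesis
    unfolding sums_def S_def[symmetric] by (rule LIMSEQ_imp_Suc)
qed

lemma matrix_exp_sums:
  "(\<lambda>k. (1 / fact k) *\<^sub>R (((**) M) ^^ k) (mat 1)) sums matrix_exp (M :: complex^'n^'n)"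
proof -
  have "linear ((**) M :: complex^'n^'n \<Rightarrow> complex^'n^'n)"
    by (rule linearI)
      (simp_all add: vec_eq_iff matrix_matrix_mult_def scaleR_sum_right sum.distrib distrib_left)
  then have bl: "bounded_linear ((**) M :: complex^'n^'n \<Rightarrow> complex^'n^'n)" by (simp add: linear_conv_bounded_linear)
  define C where "C = onorm ((**) M :: complex^'n^'n \<Rightarrow> complex^'n^'n)"
  have C0: "C \<ge> 0" unfolding C_def by (rule onorm_pos_le[OF bl])
  have nk: "norm ((((**) M) ^^ k) Y) \<le> C ^ k * norm Y" for k and Y :: "complex^'n^'n"
    unfolding C_def by (rule norm_funpow_le[OF bl])
  have "summable (\<lambda>k. (C ^ k / fact k) * norm (mat 1 :: complex^'n^'n))"
    using summable_exp_generic[of C] by (intro summable_mult2) (simp add: divide_inverse mult.commute)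
  then have "summable (\<lambda>k. (1 / fact k) *\<^sub>R (((**) M) ^^ k) (mat 1))"
    by (rule summable_comparison_test'[where N = 0])
      (use nk in \<open>simp add: divide_right_mono\<close>)
  then show ?thesis unfolding matrix_exp_def by (rule summable_sums)
qed

text \<open>The matrix in \<open>matrix_exp\<close> carries the factors \<open>z\<close> and \<open>b - a\<close> inside its entries, exactly as
  in \<open>transfer_matrix\<close>; its iterates are compared with those of the vector field
  \<open>y \<mapsto> z B y\<close> and the factor \<open>(b - a)\<^sup>k\<close> is pulled out.\<close>

lemma matrix_exp_solves_ode:
  fixes f :: "real \<Rightarrow> complex^'n" and B :: "complex^'n^'n"
  assumes "a \<le> b"
    and der: "\<And>x. x \<in> {a..b} \<Longrightarrow> (f has_vector_derivative z *s (B *v f x)) (at x within {a..b})"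
  shows "matrix_exp (map_matrix (\<lambda>c. z * c * complex_of_real (b - a)) B) *v f a = f b"
proof -
  define N where "N = map_matrix (\<lambda>c. z * c * complex_of_real (b - a)) B"
  define L where "L y = z *s (B *v y)" for y
  have lin: "linear L"
    by (rule linearI) (simp_all add: L_def vec_eq_iff matrix_vector_mult_def scaleR_sum_right
        sum_distrib_left distrib_left sum.distrib)
  then have bl: "bounded_linear L" by (simp add: linear_conv_bounded_linear)
  have NL: "N *v y = (b - a) *\<^sub>R L y" for y
    by (simp add: N_def L_def vec_eq_iff matrix_vector_mult_def sum_distrib_left scaleR_sum_right
        scaleR_conv_of_real[where 'a = complex] mult_ac)
  have pow: "(((**) N) ^^ k) (mat 1) *v y = (b - a) ^ k *\<^sub>R (L ^^ k) y" for k y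
  proof (induction k)
    case (Suc k)
    then show ?case
      by (simp flip: matrix_vector_mul_assoc add: NL linear_scale[OF lin])
  qed simp
  have "linear (\<lambda>X :: complex^'n^'n. X *v f a)"
    by (rule linearI)
      (simp_all add: vec_eq_iff matrix_vector_mult_def scaleR_sum_right sum.distrib distrib_right)
  then have bla: "bounded_linear (\<lambda>X :: complex^'n^'n. X *v f a)"
    by (simp add: linear_conv_bounded_linear)
  from bounded_linear.sums[OF bla matrix_exp_sums[of N]]
  have "(\<lambda>k. ((1 / fact k) *\<^sub>R (((**) N) ^^ k) (mat 1)) *v f a) sums (matrix_exp N *v f a)" .
  moreover have "((1 / fact k) *\<^sub>R (((**) N) ^^ k) (mat 1)) *v f a
      = ((b - a) ^ k / fact k) *\<^sub>R (L ^^ k) (f a)" for k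
    using linear_scale[OF bounded_linear.linear[OF bla], of "1 / fact k"] by (simp add: pow)
  ultimately have "(\<lambda>k. ((b - a) ^ k / fact k) *\<^sub>R (L ^^ k) (f a)) sums (matrix_exp N *v f a)"
    by simp
  moreover have "(\<lambda>k. ((b - a) ^ k / fact k) *\<^sub>R (L ^^ k) (f a)) sums f b"
    by (rule linear_ode_sums[OF bl \<open>a \<le> b\<close>]) (use der in \<open>simp add: L_def\<close>)
  ultimately show ?thesis unfolding N_def[symmetric] by (rule sums_unique2)
qed

section \<open>Eigenvalues are zeros of the characteristic function\<close>

text \<open>On a bounded interval \<open>L\<^sup>2 \<subseteq> L\<^sup>1\<close>, because \<open>\<bar>g\<bar> \<le> 1 + \<bar>g\<bar>\<^sup>2\<close>. This turns the Lebesgue integral in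
  \<open>W12_deriv\<close> into a gauge integral, for which the fundamental theorem of calculus is at hand.\<close>

lemma W12_deriv_integral:
  fixes f g :: "real \<Rightarrow> complex^'n"
  assumes W: "W12_deriv a b f g"
  shows "g integrable_on {a..b}" "\<And>x. x \<in> {a..b} \<Longrightarrow> f x = f a + integral {a..x} g"
proof -
  have m: "set_borel_measurable lebesgue {a<..<b} g"
    and i: "set_integrable lebesgue {a<..<b} (\<lambda>x. (norm (g x))\<^sup>2)"
    using W unfolding W12_deriv_def L2_on_def by auto
  have "set_integrable lebesgue {a<..<b} (\<lambda>x. 1 + (norm (g x))\<^sup>2)"
    using i by (intro set_integral_add) auto
  then have "set_integrable lebesgue {a<..<b} g"
  proof (rule set_integrable_bound[OF _ m])
    show "AE x in lebesgue. x \<in> {a<..<b} \<longrightarrow> norm (g x) \<le> norm (1 + (norm (g x))\<^sup>2)"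
    proof (intro always_eventually allI impI)
      fix x
      have "0 \<le> (norm (g x) - 1)\<^sup>2" by simp
      also have "\<dots> = (norm (g x))\<^sup>2 - 2 * norm (g x) + 1" by (simp add: power2_diff)
      finally have "norm (g x) \<le> 1 + (norm (g x))\<^sup>2" using norm_ge_zero[of "g x"] by linarith
      then show "norm (g x) \<le> norm (1 + (norm (g x))\<^sup>2)" by simp
    qed
  qed
  then have ai: "set_integrable lebesgue {a..b} g"
    using absolutely_integrable_on_open_interval[where f = g and a = a and b = b] by simp
  then show "g integrable_on {a..b}" by (rule set_lebesgue_integral_eq_integral)
  show "f x = f a + integral {a..x} g" if "x \<in> {a..b}" for x
  proof -
    have "set_integrable lebesgue {a..x} g"
      by (rule set_integrable_subset[OF ai]) (use that in auto)
    then show ?thesis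
      using W that set_lebesgue_integral_eq_integral(2) unfolding W12_deriv_def by metis
  qed
qed

text \<open>Bootstrapping: \<open>f\<close> is continuous as an indefinite integral, hence so is \<open>\<Phi> \<circ> f\<close>, which is the
  integrand up to a null set; so \<open>f\<close> is continuously differentiable up to the end points of the
  subinterval. The equation is needed on that subinterval only, which is why jumps
  of the coefficients at the other partition points are harmless.\<close>

lemma W12_deriv_classical:
  fixes f g :: "real \<Rightarrow> complex^'n"
  assumes W: "W12_deriv a b f g" and "a \<le> c" "d \<le> b"
    and ae: "AE x\<in>{c<..<d} in lebesgue. g x = \<Phi> (f x)" and \<Phi>: "continuous_on UNIV \<Phi>"
    and x: "x \<in> {c..d}"
  shows "(f has_vector_derivative \<Phi> (f x)) (at x within {c..d})"
proof -
  note ig = W12_deriv_integral(1)[OF W] and fe = W12_deriv_integral(2)[OF W]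
  have "continuous_on {a..b} (\<lambda>x. f a + integral {a..x} g)"
    by (intro continuous_intros indefinite_integral_continuous_1 ig)
  then have "continuous_on {a..b} f"
    by (rule continuous_on_eq) (simp only: fe[symmetric])
  then have cf: "continuous_on {c..d} f"
    by (rule continuous_on_subset) (use assms in auto)
  then have c\<Phi>: "continuous_on {c..d} (\<lambda>x. \<Phi> (f x))"
    by (intro continuous_on_compose2[OF \<Phi>]) auto
  obtain N where N: "N \<in> null_sets lebesgue" "\<And>x. x \<in> {c<..<d} - N \<Longrightarrow> g x = \<Phi> (f x)"
    using ae unfolding eventually_ae_filter by auto
  then have neg: "negligible (N \<union> {c, d})"
    by (simp add: negligible_iff_null_sets)
  have fx: "f y = f c + integral {c..y} (\<lambda>x. \<Phi> (f x))" if y: "y \<in> {c..d}" for y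
  proof -
    have "integral {a..c} g + integral {c..y} g = integral {a..y} g"
      by (rule Henstock_Kurzweil_Integration.integral_combine)
        (use assms y in \<open>auto intro: integrable_subinterval_real[OF ig]\<close>)
    moreover have "integral {c..y} g = integral {c..y} (\<lambda>x. \<Phi> (f x))"
      by (rule integral_spike[OF neg]) (use y N(2) in auto)
    ultimately show ?thesis
      using fe[of y] fe[of c] y assms by (simp add: add.assoc)
  qed
  have "((\<lambda>y. f c + integral {c..y} (\<lambda>x. \<Phi> (f x))) has_vector_derivative \<Phi> (f x)) (at x within {c..d})"
    using integral_has_vector_derivative[OF c\<Phi> x]
    by (auto intro!: derivative_eq_intros)
  from has_vector_derivative_transform[where g = f, OF x fx this] show ?thesis .
qed

lemma matrix_inv_mult_vec:
  fixes A :: "complex^'n^'n"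
  assumes "invertible A" shows "matrix_inv A *v (A *v v) = v"
proof -
  have "matrix_inv A ** A = mat 1"
    using someI_ex[of "\<lambda>A'. A ** A' = mat 1 \<and> A' ** A = mat 1"] assms
    unfolding invertible_def matrix_inv_def by blast
  then show ?thesis by (simp add: matrix_vector_mul_assoc)
qed

lemma coeff_fun_eq:
  assumes "strict_mono_on {0..m} \<alpha>" "s \<in> {1..m}" "\<alpha> (s - 1) < x" "x \<le> \<alpha> s"
  shows "coeff_fun m \<alpha> A x = A s"
proof -
  have "(THE s. s \<in> {1..m} \<and> \<alpha> (s - 1) < x \<and> x \<le> \<alpha> s) = s"
  proof (rule the_equality)
    fix t assume t: "t \<in> {1..m} \<and> \<alpha> (t - 1) < x \<and> x \<le> \<alpha> t"
    have mono: "\<alpha> i \<le> \<alpha> j" if "i \<le> j" "j \<le> m" for i j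
      using strict_mono_on_leD[OF assms(1)] that by auto
    show "t = s"
    proof (rule ccontr)
      assume "t \<noteq> s"
      then consider "t \<le> s - 1" | "s \<le> t - 1" by linarith
      then show False
      proof cases
        case 1
        then have "\<alpha> t \<le> \<alpha> (s - 1)" by (intro mono) (use assms in auto)
        then show False using t assms by auto
      next
        case 2
        then have "\<alpha> s \<le> \<alpha> (t - 1)" by (intro mono) (use t in auto)
        then show False using t assms by auto
      qed
    qed
  qed (use assms in auto)
  then show ?thesis by (simp add: coeff_fun_def)
qed

text \<open>The propagation formula is used with a variable right end point \<open>x\<close> in each piece: at the
  partition points it yields the transfer matrix, and at all other points it shows that
  \<open>f(\<alpha>) = 0\<close> would force \<open>f = 0\<close> everywhere.\<close>

lemma eigenvalue_of_imp_char_fun_zero: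
  fixes A :: "nat \<Rightarrow> complex^'n^'n"
  assumes mono: "strict_mono_on {0..m} \<alpha>"
    and inv: "\<And>s. s \<in> {1..m} \<Longrightarrow> invertible (A s)"
    and ev: "eigenvalue_of m \<alpha> A S T z"
  shows "char_fun m \<alpha> A S T z = 0"
proof -
  obtain f f' where W: "W12_deriv (\<alpha> 0) (\<alpha> m) f f'"
    and bc: "S *v f (\<alpha> 0) + T *v f (\<alpha> m) = 0"
    and eq: "AE x\<in>{\<alpha> 0<..<\<alpha> m} in lebesgue. z *s f x = coeff_fun m \<alpha> A x *v f' x"
    and nz: "\<not> (AE x\<in>{\<alpha> 0<..<\<alpha> m} in lebesgue. f x = 0)"
    using ev unfolding eigenvalue_of_def system_op_def by auto
  have le: "\<alpha> i \<le> \<alpha> j" if "i \<le> j" "j \<le> m" for i j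
    using strict_mono_on_leD[OF mono] that by auto
  have piece: "matrix_exp (map_matrix (\<lambda>c. z * c * complex_of_real (x - \<alpha> s)) (matrix_inv (A (Suc s))))
      *v f (\<alpha> s) = f x" if s: "s < m" and x: "x \<in> {\<alpha> s..\<alpha> (Suc s)}" for s x
  proof (rule matrix_exp_solves_ode)
    let ?B = "matrix_inv (A (Suc s))"
    fix y assume y: "y \<in> {\<alpha> s..x}"
    show "(f has_vector_derivative z *s (?B *v f y)) (at y within {\<alpha> s..x})"
    proof (rule W12_deriv_classical[OF W, where \<Phi> = "\<lambda>v. z *s (?B *v v)"])
      show "AE t\<in>{\<alpha> s<..<x} in lebesgue. f' t = z *s (?B *v f t)"
        using eq
      proof eventually_elim
        case (elim t)
        show ?case
        proof
          assume t: "t \<in> {\<alpha> s<..<x}"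
          then have "t \<in> {\<alpha> 0<..<\<alpha> m}" using x s le[of 0 s] le[of "Suc s" m] by auto
          then have "z *s f t = A (Suc s) *v f' t"
            using elim coeff_fun_eq[OF mono, of "Suc s" t A] t x s by auto
          then have "?B *v (z *s f t) = f' t"
            using matrix_inv_mult_vec[OF inv[of "Suc s"]] s by simp
          then show "f' t = z *s (?B *v f t)"
            by (simp add: vector_scalar_commute)
        qed
      qed
      show "continuous_on UNIV (\<lambda>v. z *s (?B *v v))"
      proof -
        have "linear (\<lambda>v. z *s (?B *v v))"
          by (rule linearI) (simp_all add: vec_eq_iff matrix_vector_mult_def scaleR_sum_right
              sum_distrib_left distrib_left sum.distrib)
        then show ?thesis by (simp add: linear_continuous_on linear_conv_bounded_linear)
      qed
    qed (use x s y le[of 0 s] le[of "Suc s" m] in auto)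
  qed (use x in auto)
  have tr: "f (\<alpha> s) = transfer_matrix \<alpha> A z s *v f (\<alpha> 0)" if "s \<le> m" for s
    using that
  proof (induction s)
    case (Suc s)
    then have "f (\<alpha> (Suc s)) = matrix_exp (map_matrix (\<lambda>c. z * c * complex_of_real (\<alpha> (Suc s) - \<alpha> s))
        (matrix_inv (A (Suc s)))) *v f (\<alpha> s)"
      using piece[of s "\<alpha> (Suc s)"] le[of s "Suc s"] by simp
    then show ?case using Suc by (simp add: matrix_vector_mul_assoc)
  qed simp
  have "f (\<alpha> 0) \<noteq> 0"
  proof
    assume 0: "f (\<alpha> 0) = 0"
    have "f x = 0" if x: "\<alpha> 0 < x" "x < \<alpha> m" for x
    proof -
      define s where "s = (LEAST s. x \<le> \<alpha> s)"
      have "x \<le> \<alpha> s" unfolding s_def by (rule LeastI[of _ m]) (use x in auto)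
      moreover have "s \<le> m" unfolding s_def by (rule Least_le) (use x in auto)
      moreover have "s \<noteq> 0" using \<open>x \<le> \<alpha> s\<close> x by (metis not_le)
      moreover have "\<not> x \<le> \<alpha> (s - 1)"
        using not_less_Least[of "s - 1" "\<lambda>s. x \<le> \<alpha> s"] \<open>s \<noteq> 0\<close> unfolding s_def by simp
      ultimately show ?thesis
        using piece[of "s - 1" x] tr[of "s - 1"] 0 by auto
    qed
    then show False using nz by auto
  qed
  moreover have "(S + T ** transfer_matrix \<alpha> A z m) *v f (\<alpha> 0) = 0"
    using bc tr[of m] by (simp add: matrix_vector_mult_add_rdistrib matrix_vector_mul_assoc)
  ultimately have "\<not> invertible (S + T ** transfer_matrix \<alpha> A z m)"
    by (metis invertible_def matrix_left_invertible_ker)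
  then show ?thesis
    by (simp add: char_fun_def invertible_det_nz)
qed


section \<open>Supporting lines of the polygon\<close>


text \<open>This is what makes the two ends of an edge neighbours. The line \<open>u \<bullet> x = h\<close> through \<open>a\<close> and \<open>b\<close>
  cuts the cone with apex \<open>p\<close> spanned by \<open>a\<close> and \<open>b\<close>; a point of the cone strictly on the side of \<open>p\<close> lies
  strictly between \<open>p\<close> and a point of the segment from \<open>a\<close> to \<open>b\<close>, so it cannot be extreme.\<close>

lemma extreme_point_in_cone_beyond_edge:
  fixes v :: "'a::real_inner"
  assumes K: "convex K" "a \<in> K" "b \<in> K" "p \<in> K" and ext: "v extreme_point_of K"
    and h: "u \<bullet> a = h" "u \<bullet> b = h" "u \<bullet> p < h"
    and st: "s > 0" "t > 0" "v - p = s *\<^sub>R (a - p) + t *\<^sub>R (b - p)"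
  shows "h \<le> u \<bullet> v"
proof (rule ccontr)
  assume "\<not> h \<le> u \<bullet> v"
  define q where "q = s + t"
  define w where "w = (s / q) *\<^sub>R a + (t / q) *\<^sub>R b"
  have q0: "q > 0" using st by (simp add: q_def)
  have "s / q + t / q = 1" using q0 by (simp add: q_def add_divide_distrib[symmetric])
  then have "w \<in> K" unfolding w_def
    using st q0 by (intro convexD[OF K(1-3)]) auto
  have uw: "u \<bullet> w = h"
    unfolding w_def inner_add_right inner_scaleR_right h
    using \<open>s / q + t / q = 1\<close> by (metis distrib_right mult_1)
  have v: "v = (1 - q) *\<^sub>R p + q *\<^sub>R w"
  proof -
    have "q *\<^sub>R w = s *\<^sub>R a + t *\<^sub>R b" using q0 by (simp add: w_def scaleR_right_distrib)
    then show ?thesis using st(3) by (simp add: q_def algebra_simps)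
  qed
  have "u \<bullet> v - u \<bullet> p = q * (h - u \<bullet> p)"
    unfolding v inner_add_right inner_scaleR_right uw by (simp add: algebra_simps)
  then have "q * (h - u \<bullet> p) < 1 * (h - u \<bullet> p)" using \<open>\<not> h \<le> u \<bullet> v\<close> by simp
  then have "q < 1" using h(3) by (simp add: mult_less_cancel_right)
  moreover have "p \<noteq> w" using uw h(3) by auto
  ultimately have "v \<in> open_segment p w"
    unfolding in_segment using q0 v by auto
  then show False using ext \<open>w \<in> K\<close> \<open>p \<in> K\<close> unfolding extreme_point_of_def by blast
qed

lemma between_arguments_in_cone:
  fixes a b c :: complex
  assumes "a = of_real \<rho>a * cis A" "b = of_real \<rho>b * cis B" "c = of_real \<rho>c * cis C"
    and pos: "\<rho>a > 0" "\<rho>b > 0" "\<rho>c > 0" and ang: "A < C" "C < B" "B - A < pi"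
  obtains s t where "s > 0" "t > 0" "c = s *\<^sub>R a + t *\<^sub>R b"
proof
  have s: "sin (B - A) > 0" "sin (B - C) > 0" "sin (C - A) > 0"
    using ang by (auto intro: sin_gt_zero)
  let ?s = "\<rho>c * sin (B - C) / (\<rho>a * sin (B - A))"
  let ?t = "\<rho>c * sin (C - A) / (\<rho>b * sin (B - A))"
  show "?s > 0" "?t > 0" using s pos by auto
  have "sin (B - A) * cos C = sin (B - C) * cos A + sin (C - A) * cos B"
    "sin (B - A) * sin C = sin (B - C) * sin A + sin (C - A) * sin B"
    unfolding sin_diff by algebra+
  then have "\<rho>c * cos C = \<rho>c * sin (B - C) * cos A / sin (B - A) + \<rho>c * sin (C - A) * cos B / sin (B - A)"
    "\<rho>c * sin C = \<rho>c * sin (B - C) * sin A / sin (B - A) + \<rho>c * sin (C - A) * sin B / sin (B - A)"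
    using s by (simp_all add: field_simps)
  then show "c = ?s *\<^sub>R a + ?t *\<^sub>R b"
    using pos s by (simp add: assms(1-3) complex_eq_iff)
qed

text \<open>Points on one line are ordered by the coordinate \<open>\<tau>\<close> along it. Any point other than the two
  outermost ones lies in the open segment between them and would not be extreme. Taking \<open>a\<close> as the
  first and \<open>b\<close> as the last one for the direction \<open>\<i> u\<close>, the left turn from \<open>u\<close>, fixes the orientation
  of the edge.\<close>

lemma support_face_vertex_or_edge:
  fixes \<gamma> :: "'i \<Rightarrow> complex"
  assumes fin: "finite J" "J \<noteq> {}" and inj: "inj_on \<gamma> J" and u: "u \<noteq> 0"
    and on: "\<And>r. r \<in> J \<Longrightarrow> u \<bullet> \<gamma> r = h" and ext: "\<And>r. r \<in> J \<Longrightarrow> \<gamma> r extreme_point_of K"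
  obtains a where "J = {a}"
  | a b t where "J = {a, b}" "t > 0" "\<gamma> b - \<gamma> a = t *\<^sub>R (\<i> * u)"
proof -
  define \<tau> where "\<tau> r = (\<i> * u) \<bullet> \<gamma> r" for r
  have "Min (\<tau> ` J) \<in> \<tau> ` J" "Max (\<tau> ` J) \<in> \<tau> ` J" using fin by simp_all
  then obtain a b where "a \<in> J" "b \<in> J" "\<tau> a = Min (\<tau> ` J)" "\<tau> b = Max (\<tau> ` J)" by auto
  then have a: "a \<in> J" "\<And>r. r \<in> J \<Longrightarrow> \<tau> a \<le> \<tau> r" and b: "b \<in> J" "\<And>r. r \<in> J \<Longrightarrow> \<tau> r \<le> \<tau> b"
    using fin by auto
  have nu: "u \<bullet> u > 0" using u by simp
  have diff: "\<gamma> r - \<gamma> q = ((\<tau> r - \<tau> q) / (u \<bullet> u)) *\<^sub>R (\<i> * u)" if "r \<in> J" "q \<in> J" for r q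
  proof -
    have "(u \<bullet> u) *\<^sub>R x = (u \<bullet> x) *\<^sub>R u + ((\<i> * u) \<bullet> x) *\<^sub>R (\<i> * u)" for x
      by (simp add: complex_eq_iff inner_complex_def algebra_simps)
    from this[of "\<gamma> r - \<gamma> q"] have "(u \<bullet> u) *\<^sub>R (\<gamma> r - \<gamma> q) = (\<tau> r - \<tau> q) *\<^sub>R (\<i> * u)"
      using on that by (simp add: inner_diff_right \<tau>_def)
    then have "(1 / (u \<bullet> u)) *\<^sub>R ((u \<bullet> u) *\<^sub>R (\<gamma> r - \<gamma> q)) = (1 / (u \<bullet> u)) *\<^sub>R ((\<tau> r - \<tau> q) *\<^sub>R (\<i> * u))"
      by simp
    then show ?thesis using nu by simp
  qed
  have inj\<tau>: "r = q" if "r \<in> J" "q \<in> J" "\<tau> r = \<tau> q" for r q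
    using diff[of r q] that inj by (auto dest: inj_onD)
  have strict: "\<tau> r < \<tau> q" if "r \<in> J" "q \<in> J" "\<tau> r \<le> \<tau> q" "r \<noteq> q" for r q
    using inj\<tau>[of r q] that by (cases "\<tau> r = \<tau> q") auto
  show thesis
  proof (cases "a = b")
    case True
    have "r = a" if r: "r \<in> J" for r
      using order_antisym[OF b(2)[OF r, folded True] a(2)[OF r]] by (rule inj\<tau>[OF r a(1)])
    then have "J = {a}" using a(1) by blast
    then show ?thesis by (rule that(1))
  next
    case False
    then have ab: "\<tau> a < \<tau> b" using a b strict by blast
    have "c = a \<or> c = b" if c: "c \<in> J" for c
    proof (rule ccontr)
      assume n: "\<not> (c = a \<or> c = b)"
      then have ac: "\<tau> a < \<tau> c" "\<tau> c < \<tau> b" using a b c strict by blast+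
      define q where "q = (\<tau> c - \<tau> a) / (\<tau> b - \<tau> a)"
      have q: "0 < q" "q < 1" using ac by (auto simp: q_def)
      have "\<gamma> c - \<gamma> a = q *\<^sub>R (\<gamma> b - \<gamma> a)"
        using diff[OF c a(1)] diff[OF b(1) a(1)] ab by (simp add: q_def)
      then have "\<gamma> c = (1 - q) *\<^sub>R \<gamma> a + q *\<^sub>R \<gamma> b" by (simp add: algebra_simps)
      moreover have "\<gamma> a \<noteq> \<gamma> b" using False a b inj by (auto dest: inj_onD)
      ultimately have "\<gamma> c \<in> open_segment (\<gamma> a) (\<gamma> b)" unfolding in_segment using q by auto
      then show False using ext[OF c] ext[OF a(1)] ext[OF b(1)] unfolding extreme_point_of_def by blast
    qed
    then have "J = {a, b}" using a b by auto
    moreover have "(\<tau> b - \<tau> a) / (u \<bullet> u) > 0" using ab nu by simp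
    ultimately show ?thesis using that(2) diff[OF b(1) a(1)] by blast
  qed
qed

text \<open>Otherwise the segment from \<open>x\<close> to \<open>p\<close> could be prolonged within \<open>K\<close> beyond \<open>p\<close>, across the
  supporting hyperplane.\<close>

lemma rel_interior_below_support:
  fixes K :: "'a::euclidean_space set"
  assumes K: "convex K" and le: "\<And>x. x \<in> K \<Longrightarrow> u \<bullet> x \<le> h" and p: "p \<in> rel_interior K"
    and x: "x \<in> K" "u \<bullet> x < h"
  shows "u \<bullet> p < h"
proof -
  obtain e where e: "e > 1" "(1 - e) *\<^sub>R x + e *\<^sub>R p \<in> K"
    using convex_rel_interior_iff[OF K] x p by blast
  have "(1 - e) * (u \<bullet> x) + e * (u \<bullet> p) \<le> h"
    using le[OF e(2)] by (simp add: inner_add_right)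
  moreover have "(1 - e) * h < (1 - e) * (u \<bullet> x)" using e x by simp
  ultimately have "e * (u \<bullet> p) < e * h" by (simp add: algebra_simps)
  then show ?thesis using e by simp
qed

lemma interior_below_support:
  fixes K :: "'a::euclidean_space set"
  assumes u: "u \<noteq> 0" and le: "\<And>x. x \<in> K \<Longrightarrow> u \<bullet> x \<le> h" and p: "p \<in> interior K"
  shows "u \<bullet> p < h"
proof -
  obtain e where e: "e > 0" "cball p e \<subseteq> K" using p mem_interior_cball by blast
  have "p + (e / norm u) *\<^sub>R u \<in> K" using e u by (auto simp: dist_norm subset_iff)
  from le[OF this] have "u \<bullet> p + (e / norm u) * (u \<bullet> u) \<le> h" by (simp add: inner_add_right)
  moreover have "(e / norm u) * (u \<bullet> u) > 0" using e u by simp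
  ultimately show ?thesis by linarith
qed

text \<open>Seen from the inner point \<open>p\<close>, the edge from \<open>a\<close> to \<open>b\<close> turns left by an angle in \<open>(0, \<pi>)\<close>, as the sign
  of a cross product shows, and no vertex has its argument strictly between those of the two ends.
  As the arguments \<open>\<theta>\<close> increase over less than a full turn, either \<open>a < b\<close> and there is no index between
  them, or the edge crosses the cut between \<open>\<theta> Q\<close> and \<open>\<theta> 1 + 2 \<pi>\<close>, so that \<open>a = Q\<close> and \<open>b = 1\<close>. A segment,
  where \<open>p\<close> may lie on the edge itself, is treated apart: with two vertices each one precedes the
  other.\<close>

lemma anticlockwise_consecutive:
  assumes ac: "anticlockwise K Q \<gamma>" and K: "convex K"
    and ext: "\<And>r. r \<in> {1..Q} \<Longrightarrow> \<gamma> r extreme_point_of K"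
    and ab: "a \<in> {1..Q}" "b \<in> {1..Q}" "u \<noteq> 0" "t > 0" "\<gamma> b - \<gamma> a = t *\<^sub>R (\<i> * u)"
    and le: "\<And>x. x \<in> K \<Longrightarrow> u \<bullet> x \<le> u \<bullet> \<gamma> a"
    and lt: "\<And>r. r \<in> {1..Q} - {a, b} \<Longrightarrow> u \<bullet> \<gamma> r < u \<bullet> \<gamma> a"
  shows "a = prev_index Q b"
proof -
  define h where "h = u \<bullet> \<gamma> a"
  have neab: "\<gamma> a \<noteq> \<gamma> b" using ab by auto
  then have "a \<noteq> b" by auto
  have ub: "u \<bullet> \<gamma> b = h"
  proof -
    have "u \<bullet> (\<gamma> b - \<gamma> a) = 0" unfolding ab(5) by (simp add: inner_complex_def)
    then show ?thesis by (simp add: h_def inner_diff_right)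
  qed
  show ?thesis
  proof (cases "{1..Q} = {a, b}")
    case True
    then have "card {1..Q} = 2" using \<open>a \<noteq> b\<close> by simp
    then have "Q = 2" by simp
    then show ?thesis using ab \<open>a \<noteq> b\<close> by (auto simp: prev_index_def)
  next
    case False
    then obtain x where x: "x \<in> {1..Q} - {a, b}" using ab by blast
    obtain p \<theta> where p: "p \<in> rel_interior K" and \<theta>: "strict_mono_on {1..Q} \<theta>" "\<theta> Q < \<theta> 1 + 2 * pi"
      and pol: "\<And>r. r \<in> {1..Q} \<Longrightarrow> \<gamma> r - p = complex_of_real (cmod (\<gamma> r - p)) * cis (\<theta> r)"
      using ac unfolding anticlockwise_def by blast
    have inK: "\<gamma> r \<in> K" if "r \<in> {1..Q}" for r using ext[OF that] by (simp add: extreme_point_of_def)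
    have up: "u \<bullet> p < h"
      by (rule rel_interior_below_support[OF K _ p, of u h "\<gamma> x"]) (use le lt x inK in \<open>auto simp: h_def\<close>)
    have pK: "p \<in> K" using p rel_interior_subset by blast
    have \<rho>: "cmod (\<gamma> r - p) > 0" if r: "r \<in> {1..Q}" for r
    proof -
      have "K \<noteq> {\<gamma> r}" using inK[OF ab(1)] inK[OF ab(2)] neab by auto
      then show ?thesis using extreme_point_not_in_REL_INTERIOR[OF ext[OF r]] p by auto
    qed
    \<comment> \<open>The multiples of \<open>2 \<pi>\<close> serve the edge that crosses the cut, where the arguments of \<open>b\<close> and of
      the vertices before \<open>b\<close> have to be raised by a full turn.\<close>
    have no_between: False
      if c: "c \<in> {1..Q} - {a, b}" and ang: "\<theta> a < \<theta> c + 2 * pi * real i" "\<theta> c + 2 * pi * real i < \<theta> b + 2 * pi * real j"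
        "\<theta> b + 2 * pi * real j - \<theta> a < pi" for c i j
    proof -
      have cisp: "cis (x + 2 * pi * real n) = cis x" for x n
        by (simp add: cis_mult[symmetric])
      have cQ: "c \<in> {1..Q}" using c by simp
      obtain s t where st: "s > 0" "t > 0" "\<gamma> c - p = s *\<^sub>R (\<gamma> a - p) + t *\<^sub>R (\<gamma> b - p)"
      proof (rule between_arguments_in_cone)
        show "\<gamma> a - p = of_real (cmod (\<gamma> a - p)) * cis (\<theta> a)" by (rule pol[OF ab(1)])
        show "\<gamma> b - p = of_real (cmod (\<gamma> b - p)) * cis (\<theta> b + 2 * pi * real j)"
          unfolding cisp by (rule pol[OF ab(2)])
        show "\<gamma> c - p = of_real (cmod (\<gamma> c - p)) * cis (\<theta> c + 2 * pi * real i)"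
          unfolding cisp by (rule pol[OF cQ])
      qed (use \<rho> ab cQ ang in auto)
      have "h \<le> u \<bullet> \<gamma> c"
        by (rule extreme_point_in_cone_beyond_edge[OF K inK[OF ab(1)] inK[OF ab(2)] pK ext[OF cQ] _ ub up st])
          (simp add: h_def)
      then show False using lt[OF c] by (simp add: h_def)
    qed
    \<comment> \<open>The cross product of \<open>\<gamma> a - p\<close> and \<open>\<gamma> b - p\<close>, computed in polar and in Cartesian coordinates.\<close>
    have sin: "sin (\<theta> b - \<theta> a) > 0"
    proof -
      define A B where "A = cmod (\<gamma> a - p)" and "B = cmod (\<gamma> b - p)"
      have "A * B * sin (\<theta> b - \<theta> a) = Im (cnj (of_real A * cis (\<theta> a)) * (of_real B * cis (\<theta> b)))"
        by (simp add: sin_diff algebra_simps)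
      also have "\<dots> = Im (cnj (\<gamma> a - p) * (\<gamma> b - p))"
        using pol[OF ab(1)] pol[OF ab(2)] unfolding A_def B_def by metis
      also have "\<gamma> b - p = (\<gamma> a - p) + t *\<^sub>R (\<i> * u)" using ab(5) by (simp add: algebra_simps)
      also have "Im (cnj (\<gamma> a - p) * ((\<gamma> a - p) + t *\<^sub>R (\<i> * u))) = t * (u \<bullet> (\<gamma> a - p))"
        by (simp add: inner_complex_def algebra_simps)
      also have "\<dots> > 0" using ab(4) up by (simp add: h_def inner_diff_right)
      finally show ?thesis using \<rho>[OF ab(1)] \<rho>[OF ab(2)] unfolding A_def B_def
        by (metis mult_pos_pos zero_less_mult_pos)
    qed
    have mono: "\<theta> i < \<theta> j" if "i < j" "1 \<le> i" "j \<le> Q" for i j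
      using strict_mono_onD[OF \<theta>(1)] that by auto
    have mono': "\<theta> i \<le> \<theta> j" if "i \<le> j" "1 \<le> i" "j \<le> Q" for i j
      using mono[of i j] that by (cases "i = j") auto
    show ?thesis
    proof (cases "a < b")
      case True
      have "\<theta> b - \<theta> a < 2 * pi" using mono'[of 1 a] mono'[of b Q] ab \<theta>(2) by auto
      then have "\<theta> b - \<theta> a < pi" using sin sin_le_zero[of "\<theta> b - \<theta> a"] by fastforce
      then have "\<not> a + 1 < b"
        using no_between[of "a + 1" 0 0] mono[of a "a + 1"] mono[of "a + 1" b] ab by auto
      then show ?thesis using True ab by (auto simp: prev_index_def)
    next
      case False
      then have ba: "b < a" using \<open>a \<noteq> b\<close> by simp
      have "\<theta> b < \<theta> a" using mono[OF ba] ab by auto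
      have "sin (\<theta> b + 2 * pi - \<theta> a) > 0"
        using sin sin_periodic[of "\<theta> b - \<theta> a"] by (simp add: algebra_simps)
      then have lt\<pi>: "\<theta> b + 2 * pi - \<theta> a < pi"
        using sin_le_zero[of "\<theta> b + 2 * pi - \<theta> a"] \<open>\<theta> b < \<theta> a\<close> by fastforce
      have "a = Q"
        using no_between[of Q 0 1] lt\<pi> mono[of a Q] mono'[of 1 b] ab \<theta>(2) ba by fastforce
      moreover have "b = 1"
        using no_between[of 1 1 1] lt\<pi> mono[of 1 b] mono'[of a Q] ab \<theta>(2) ba by fastforce
      ultimately show ?thesis by (simp add: prev_index_def)
    qed
  qed
qed

text \<open>A linear functional attains its maximum over \<open>K\<close> at some \<open>\<gamma>\<^sub>r\<close>, never in the interior. In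
  the generic case all the maximising \<open>\<gamma>\<^sub>r\<close> are therefore vertices.\<close>

lemma generic_support_face:
  fixes \<gamma> :: "nat \<Rightarrow> complex"
  assumes gen: "generic_case R Q \<gamma>" and inj: "inj_on \<gamma> {1..R}" and u: "u \<noteq> 0"
  obtains a where "a \<in> {1..R}" "\<And>r. r \<in> {1..R} - {a} \<Longrightarrow> u \<bullet> \<gamma> r < u \<bullet> \<gamma> a"
  | b t where "b \<in> {1..Q}" "prev_index Q b \<in> {1..Q}" "prev_index Q b \<noteq> b" "t > 0"
      "\<gamma> b - \<gamma> (prev_index Q b) = t *\<^sub>R (\<i> * u)"
      "\<And>r. r \<in> {1..R} - {prev_index Q b, b} \<Longrightarrow> u \<bullet> \<gamma> r < u \<bullet> \<gamma> b"
proof -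
  define K where "K = convex hull (\<gamma> ` {1..R})"
  have g: "1 \<le> Q" "Q \<le> R" "\<gamma> ` {1..Q} = {v. v extreme_point_of K}" "anticlockwise K Q \<gamma>"
    "\<gamma> ` {Q<..R} \<subseteq> interior K"
    using gen unfolding generic_case_def Let_def K_def by auto
  define h where "h = Max ((\<lambda>r. u \<bullet> \<gamma> r) ` {1..R})"
  define J where "J = {r \<in> {1..R}. u \<bullet> \<gamma> r = h}"
  have le: "u \<bullet> \<gamma> r \<le> h" if "r \<in> {1..R}" for r unfolding h_def using that by auto
  have "h \<in> (\<lambda>r. u \<bullet> \<gamma> r) ` {1..R}" unfolding h_def using g by (intro Max_in) auto
  then have J: "finite J" "J \<noteq> {}" by (auto simp: J_def)
  have cK: "convex K" by (simp add: K_def)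
  have leK: "u \<bullet> x \<le> h" if "x \<in> K" for x
  proof -
    have "K \<subseteq> {x. u \<bullet> x \<le> h}" unfolding K_def
      by (rule hull_minimal) (use le in \<open>auto simp: convex_halfspace_le\<close>)
    then show ?thesis using that by auto
  qed
  have ext: "\<gamma> r extreme_point_of K" if "r \<in> {1..Q}" for r using g(3) that by blast
  have JQ: "r \<in> {1..Q}" if "r \<in> J" for r
  proof (rule ccontr)
    assume "r \<notin> {1..Q}"
    then have "\<gamma> r \<in> interior K" using g(5) that by (auto simp: J_def)
    from interior_below_support[OF u leK this] show False using that by (simp add: J_def)
  qed
  have lt: "u \<bullet> \<gamma> r < h" if "r \<in> {1..R} - J" for r
    using le[of r] that by (auto simp: J_def)
  note single = that(1) and double = that(2)
  show thesis
  proof (rule support_face_vertex_or_edge[OF J, where \<gamma> = \<gamma> and u = u and h = h and K = K])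
    show "inj_on \<gamma> J" using inj by (rule inj_on_subset) (auto simp: J_def)
    show "thesis" if "J = {a}" for a
    proof (rule single[of a])
      have "u \<bullet> \<gamma> a = h" "a \<in> {1..R}" using that by (auto simp: J_def)
      then show "a \<in> {1..R}" "\<And>r. r \<in> {1..R} - {a} \<Longrightarrow> u \<bullet> \<gamma> r < u \<bullet> \<gamma> a"
        using lt that by auto
    qed
    show "thesis" if ab: "J = {a, b}" "t > 0" "\<gamma> b - \<gamma> a = t *\<^sub>R (\<i> * u)" for a b t
    proof -
      have aQ: "a \<in> {1..Q}" "b \<in> {1..Q}" using JQ ab by auto
      have h: "u \<bullet> \<gamma> a = h" "u \<bullet> \<gamma> b = h" using ab(1) by (auto simp: J_def)
      have pr: "a = prev_index Q b"
        by (rule anticlockwise_consecutive[OF g(4) cK ext aQ u ab(2,3)])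
          (use leK h lt g ab(1) in auto)
      have "a \<noteq> b" using ab u by auto
      show ?thesis
        by (rule double[of b t]) (use pr aQ \<open>a \<noteq> b\<close> ab lt h in auto)
    qed
  qed (use u ext JQ in \<open>auto simp: J_def\<close>)
qed


section \<open>Zeros of exponential sums\<close>


lemma filterlim_inner_direction:
  fixes z :: "nat \<Rightarrow> 'a::real_inner"
  assumes z: "filterlim (\<lambda>n. norm (z n)) at_top sequentially"
    and dir: "(\<lambda>n. sgn (z n)) \<longlonglongrightarrow> u" and v: "u \<bullet> v > 0"
  shows "filterlim (\<lambda>n. z n \<bullet> v) at_top sequentially"
proof -
  have "filterlim (\<lambda>n. (sgn (z n) \<bullet> v) * norm (z n)) at_top sequentially"
    by (rule filterlim_tendsto_pos_mult_at_top[OF tendsto_inner[OF dir tendsto_const] v z])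
  moreover have "(sgn (z n) \<bullet> v) * norm (z n) = z n \<bullet> v" for n
    by (cases "z n = 0") (simp_all add: sgn_div_norm)
  ultimately show ?thesis by simp
qed

text \<open>The quotient of the term of index \<open>r\<close> by the one of index \<open>a\<close> has modulus proportional to
  \<open>e\<^bsup>- z\<^sub>n \<bullet> (\<gamma>\<^sub>a - \<gamma>\<^sub>r)\<^esup>\<close>, and the exponent tends to \<open>- \<infinity>\<close> when \<open>z\<^sub>n\<close> goes to infinity in the
  direction \<open>u\<close>.\<close>

lemma eventually_rest_dominated:
  fixes \<gamma> :: "'i \<Rightarrow> complex"
  assumes z: "filterlim (\<lambda>n. norm (z n)) at_top sequentially" "(\<lambda>n. sgn (z n)) \<longlonglongrightarrow> u"
    and lt: "\<And>r. r \<in> I \<Longrightarrow> u \<bullet> \<gamma> r < u \<bullet> \<gamma> a" and "\<eta> > 0" "\<delta> a \<noteq> 0"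
  shows "\<forall>\<^sub>F n in sequentially.
    (\<Sum>r\<in>I. cmod (\<delta> r) * exp (z n \<bullet> \<gamma> r)) < \<eta> * (cmod (\<delta> a) * exp (z n \<bullet> \<gamma> a))"
proof -
  have "(\<lambda>n. exp (- (z n \<bullet> (\<gamma> a - \<gamma> r)))) \<longlonglongrightarrow> 0" if "r \<in> I" for r
    by (rule filterlim_compose[OF exp_at_bot])
      (use filterlim_inner_direction[OF z, of "\<gamma> a - \<gamma> r"] lt[OF that]
        in \<open>simp add: inner_diff_right filterlim_uminus_at_bot\<close>)
  then have "(\<lambda>n. \<Sum>r\<in>I. cmod (\<delta> r) * exp (- (z n \<bullet> (\<gamma> a - \<gamma> r)))) \<longlonglongrightarrow> (\<Sum>r\<in>I. cmod (\<delta> r) * 0)"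
    by (intro tendsto_sum tendsto_mult_left)
  then have "\<forall>\<^sub>F n in sequentially.
      (\<Sum>r\<in>I. cmod (\<delta> r) * exp (- (z n \<bullet> (\<gamma> a - \<gamma> r)))) < \<eta> * cmod (\<delta> a)"
    using assms(4,5) by (intro order_tendstoD(2)) auto
  then show ?thesis
  proof eventually_elim
    case (elim n)
    have "cmod (\<delta> r) * exp (z n \<bullet> \<gamma> r)
        = (cmod (\<delta> r) * exp (- (z n \<bullet> (\<gamma> a - \<gamma> r)))) * exp (z n \<bullet> \<gamma> a)" for r
      by (simp add: inner_diff_right mult.assoc flip: exp_add)
    then have "(\<Sum>r\<in>I. cmod (\<delta> r) * exp (z n \<bullet> \<gamma> r))
        = (\<Sum>r\<in>I. cmod (\<delta> r) * exp (- (z n \<bullet> (\<gamma> a - \<gamma> r)))) * exp (z n \<bullet> \<gamma> a)"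
      by (simp only: sum_distrib_right)
    also have "\<dots> < (\<eta> * cmod (\<delta> a)) * exp (z n \<bullet> \<gamma> a)"
      by (rule mult_strict_right_mono[OF elim]) simp
    finally show ?case by (simp add: mult.assoc)
  qed
qed

lemma exponential_sum_nonzero:
  fixes \<gamma> :: "'i \<Rightarrow> complex"
  assumes "finite I" "a \<in> I"
    and lt: "(\<Sum>r\<in>I - {a}. cmod (\<delta> r) * exp (z \<bullet> \<gamma> r)) < cmod (\<delta> a) * exp (z \<bullet> \<gamma> a)"
  shows "(\<Sum>r\<in>I. \<delta> r * exp (z * cnj (\<gamma> r))) \<noteq> 0"
proof
  assume 0: "(\<Sum>r\<in>I. \<delta> r * exp (z * cnj (\<gamma> r))) = 0"
  have n: "cmod (\<delta> r * exp (z * cnj (\<gamma> r))) = cmod (\<delta> r) * exp (z \<bullet> \<gamma> r)" for r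
    by (simp add: norm_mult inner_complex_def)
  have "\<delta> a * exp (z * cnj (\<gamma> a)) = - (\<Sum>r\<in>I - {a}. \<delta> r * exp (z * cnj (\<gamma> r)))"
    using 0 sum.remove[OF assms(1,2), of "\<lambda>r. \<delta> r * exp (z * cnj (\<gamma> r))"]
    by (simp add: add_eq_0_iff2)
  then have "cmod (\<delta> a) * exp (z \<bullet> \<gamma> a) = cmod (\<Sum>r\<in>I - {a}. \<delta> r * exp (z * cnj (\<gamma> r)))"
    by (metis n norm_minus_cancel)
  also have "\<dots> \<le> (\<Sum>r\<in>I - {a}. cmod (\<delta> r) * exp (z \<bullet> \<gamma> r))"
    by (rule order_trans[OF norm_sum]) (simp only: n order_refl)
  finally show False using lt by simp
qed

text \<open>The left-hand side is \<open>\<bar>d\<bar>\<close>, where \<open>d\<close> is the logarithm of the quotient of the moduli of the two leading terms.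
  If it exceeded \<open>\<epsilon>\<close>, the smaller leading term would be less than \<open>e\<^bsup>-\<epsilon>\<^esup>\<close> times the larger
  one, and the remaining terms together less than \<open>1 - e\<^bsup>-\<epsilon>\<^esup>\<close> times it; so the larger one
  could not be cancelled.\<close>

lemma two_term_zero_in_strip:
  fixes \<gamma> :: "'i \<Rightarrow> complex"
  assumes fin: "finite I" and ab: "a \<in> I" "b \<in> I" "a \<noteq> b" and nz: "\<delta> a \<noteq> 0" "\<delta> b \<noteq> 0"
    and zero: "(\<Sum>r\<in>I. \<delta> r * exp (z * cnj (\<gamma> r))) = 0"
    and rest: "\<And>c. c \<in> {a, b} \<Longrightarrow> (\<Sum>r\<in>I - {a, b}. cmod (\<delta> r) * exp (z \<bullet> \<gamma> r))
        < (1 - exp (- \<epsilon>)) * (cmod (\<delta> c) * exp (z \<bullet> \<gamma> c))"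
  shows "\<bar>z \<bullet> (\<gamma> b - \<gamma> a) - ln (cmod (\<delta> a / \<delta> b))\<bar> \<le> \<epsilon>"
proof (rule ccontr)
  define d where "d = z \<bullet> (\<gamma> b - \<gamma> a) - ln (cmod (\<delta> a / \<delta> b))"
  define x where "x c = cmod (\<delta> c) * exp (z \<bullet> \<gamma> c)" for c
  have pos: "x a > 0" "x b > 0" using nz by (simp_all add: x_def)
  have d: "x b = x a * exp d"
    using nz by (simp add: x_def d_def exp_diff inner_diff_right norm_divide)
  have small: "x c' < exp (- \<epsilon>) * x c \<Longrightarrow> False" if "{c, c'} = {a, b}" for c c'
  proof -
    assume less: "x c' < exp (- \<epsilon>) * x c"
    have c: "c \<in> I" "c' \<in> I - {c}" using that ab by (auto simp: doubleton_eq_iff)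
    have "(\<Sum>r\<in>I - {c}. x r) = x c' + (\<Sum>r\<in>I - {c} - {c'}. x r)"
      by (rule sum.remove) (use fin c in auto)
    also have "I - {c} - {c'} = I - {a, b}" using that by (auto simp: doubleton_eq_iff)
    also have "x c' + (\<Sum>r\<in>I - {a, b}. x r) < exp (- \<epsilon>) * x c + (1 - exp (- \<epsilon>)) * x c"
      using less rest[of c] that unfolding x_def by (intro add_strict_mono) auto
    also have "\<dots> = x c" by (simp add: algebra_simps)
    finally show False
      using exponential_sum_nonzero[OF fin c(1), of \<delta> z \<gamma>] zero by (simp add: x_def)
  qed
  assume "\<not> \<bar>z \<bullet> (\<gamma> b - \<gamma> a) - ln (cmod (\<delta> a / \<delta> b))\<bar> \<le> \<epsilon>"
  then consider "d > \<epsilon>" | "d < - \<epsilon>" unfolding d_def by linarith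
  then show False
  proof cases
    case 1
    have "x a = exp (- d) * x b" by (simp add: d exp_minus)
    also have "\<dots> < exp (- \<epsilon>) * x b" using 1 pos by simp
    finally show False using small[of b a] by auto
  next
    case 2
    then have "x b < exp (- \<epsilon>) * x a" using d pos by (simp add: mult.commute)
    then show False using small[of a b] by auto
  qed
qed

lemma edge_normal_eq:
  assumes "cmod u = 1" "t > 0" "\<gamma> b - \<gamma> (prev_index Q b) = t *\<^sub>R (\<i> * u)"
  shows "edge_normal Q \<gamma> b = u"
  using assms by (simp add: edge_normal_def norm_mult scaleR_conv_of_real)

text \<open>The compactness of the unit circle replaces a subdivision of the plane into sectors with
  uniform estimates: only one limiting direction \<open>u\<close> has to be considered.\<close>

lemma exponential_sum_zeros_in_strips:
  assumes gen: "generic_case R Q \<gamma>" and inj: "inj_on \<gamma> {1..R}"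
    and nz: "\<And>r. r \<in> {1..R} \<Longrightarrow> \<delta> r \<noteq> 0" and \<epsilon>: "\<epsilon> > 0"
  shows "\<exists>B. \<forall>z. (\<Sum>r=1..R. \<delta> r * exp (z * cnj (\<gamma> r))) = 0 \<and> cmod z > B \<longrightarrow>
    (\<exists>r\<in>{1..Q}. z \<in> strip Q \<gamma> \<delta> \<epsilon> r)"
proof (rule ccontr)
  define F where "F z = (\<Sum>r=1..R. \<delta> r * exp (z * cnj (\<gamma> r)))" for z
  assume "\<not> ?thesis"
  then have "\<forall>n. \<exists>z. F z = 0 \<and> cmod z > real n \<and> (\<forall>r\<in>{1..Q}. z \<notin> strip Q \<gamma> \<delta> \<epsilon> r)"
    unfolding F_def by blast
  then obtain w where w: "\<And>n. F (w n) = 0" "\<And>n. cmod (w n) > real n"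
    "\<And>n r. r \<in> {1..Q} \<Longrightarrow> w n \<notin> strip Q \<gamma> \<delta> \<epsilon> r" by metis
  have "sgn (w n) \<in> sphere 0 1" for n
    using w(2)[of n] by (auto simp: norm_sgn)
  then obtain u \<phi> where u: "u \<in> sphere 0 1" and \<phi>: "strict_mono \<phi>"
    and lim: "((\<lambda>n. sgn (w n)) \<circ> \<phi>) \<longlonglongrightarrow> u"
    using compact_imp_seq_compact[OF compact_sphere[of "0 :: complex" 1]]
    by (metis seq_compactE)
  define z where "z n = w (\<phi> n)" for n
  have dir: "(\<lambda>n. sgn (z n)) \<longlonglongrightarrow> u" using lim by (simp add: z_def comp_def)
  have "real n \<le> cmod (z n)" for n
    using w(2)[of "\<phi> n"] seq_suble[OF \<phi>, of n] by (simp add: z_def)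
  then have inf: "filterlim (\<lambda>n. norm (z n)) at_top sequentially"
    by (intro filterlim_at_top_mono[OF filterlim_real_sequentially always_eventually]) auto
  have QR: "Q \<le> R" using gen by (auto simp: generic_case_def Let_def)
  have u1: "cmod u = 1" "u \<noteq> 0" using u by auto
  show False
  proof (rule generic_support_face[OF gen inj u1(2)])
    fix a assume a: "a \<in> {1..R}" "\<And>r. r \<in> {1..R} - {a} \<Longrightarrow> u \<bullet> \<gamma> r < u \<bullet> \<gamma> a"
    have "\<forall>\<^sub>F n in sequentially. (\<Sum>r\<in>{1..R} - {a}. cmod (\<delta> r) * exp (z n \<bullet> \<gamma> r))
        < 1 * (cmod (\<delta> a) * exp (z n \<bullet> \<gamma> a))"
      by (rule eventually_rest_dominated[OF inf dir]) (use a nz in auto)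
    then obtain n where "(\<Sum>r\<in>{1..R} - {a}. cmod (\<delta> r) * exp (z n \<bullet> \<gamma> r))
        < cmod (\<delta> a) * exp (z n \<bullet> \<gamma> a)"
      using eventually_happens' by fastforce
    then have "F (z n) \<noteq> 0"
      unfolding F_def by (intro exponential_sum_nonzero) (use a in auto)
    then show False using w(1) by (simp add: z_def)
  next
    fix b t
    define a where "a = prev_index Q b"
    assume "b \<in> {1..Q}" "prev_index Q b \<in> {1..Q}" "prev_index Q b \<noteq> b" "t > 0"
      "\<gamma> b - \<gamma> (prev_index Q b) = t *\<^sub>R (\<i> * u)"
      "\<And>r. r \<in> {1..R} - {prev_index Q b, b} \<Longrightarrow> u \<bullet> \<gamma> r < u \<bullet> \<gamma> b"
    then have b: "b \<in> {1..Q}" and ab: "a \<in> {1..R}" "b \<in> {1..R}" "a \<noteq> b" and t: "t > 0"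
      and diff: "\<gamma> b - \<gamma> a = t *\<^sub>R (\<i> * u)"
      and lt: "\<And>r. r \<in> {1..R} - {a, b} \<Longrightarrow> u \<bullet> \<gamma> r < u \<bullet> \<gamma> b"
      using QR by (auto simp: a_def)
    have e: "edge_normal Q \<gamma> b = u"
      using edge_normal_eq[OF u1(1) t] diff by (simp add: a_def)
    have "u \<bullet> (\<gamma> b - \<gamma> a) = 0" unfolding diff by (simp add: inner_complex_def)
    then have eqab: "u \<bullet> \<gamma> a = u \<bullet> \<gamma> b" by (simp add: inner_diff_right)
    have dom: "\<forall>\<^sub>F n in sequentially. (\<Sum>r\<in>{1..R} - {a, b}. cmod (\<delta> r) * exp (z n \<bullet> \<gamma> r))
        < (1 - exp (- \<epsilon>)) * (cmod (\<delta> c) * exp (z n \<bullet> \<gamma> c))" if "c \<in> {a, b}" for c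
      by (rule eventually_rest_dominated[OF inf dir]) (use lt eqab nz ab \<epsilon> that in auto)
    have "\<forall>\<^sub>F n in sequentially. z n \<bullet> u \<ge> \<gamma> b \<bullet> u"
      using filterlim_inner_direction[OF inf dir, of u] u1 by (simp add: filterlim_at_top)
    with dom[of a] dom[of b] have "\<forall>\<^sub>F n in sequentially. z n \<bullet> u \<ge> \<gamma> b \<bullet> u \<and>
        (\<forall>c\<in>{a, b}. (\<Sum>r\<in>{1..R} - {a, b}. cmod (\<delta> r) * exp (z n \<bullet> \<gamma> r))
          < (1 - exp (- \<epsilon>)) * (cmod (\<delta> c) * exp (z n \<bullet> \<gamma> c)))"
      by (auto intro: eventually_conj)
    from eventually_happens'[OF sequentially_bot this]
    obtain n where n: "z n \<bullet> u \<ge> \<gamma> b \<bullet> u"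
      "\<And>c. c \<in> {a, b} \<Longrightarrow> (\<Sum>r\<in>{1..R} - {a, b}. cmod (\<delta> r) * exp (z n \<bullet> \<gamma> r))
          < (1 - exp (- \<epsilon>)) * (cmod (\<delta> c) * exp (z n \<bullet> \<gamma> c))"
      by blast
    have "\<bar>z n \<bullet> (\<gamma> b - \<gamma> a) - ln (cmod (\<delta> a / \<delta> b))\<bar> \<le> \<epsilon>"
      using w(1) by (intro two_term_zero_in_strip[of "{1..R}"] n(2)) (use ab nz in \<open>auto simp: z_def F_def\<close>)
    then have "z n \<in> strip Q \<gamma> \<delta> \<epsilon> b"
      using n(1) by (simp add: strip_def e k_const_def a_def abs_le_iff)
    then show False using w(3)[OF b] by (simp add: z_def)
  qed
qed

theorem theorem2:
  fixes m :: nat and \<alpha> :: "nat \<Rightarrow> real"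
    and A :: "nat \<Rightarrow> complex^'n^'n" and S T :: "complex^'n^'n"
    and R Q :: nat and \<gamma> \<delta> :: "nat \<Rightarrow> complex" and \<epsilon> :: real
  assumes "m \<ge> 1"
    and "strict_mono_on {0..m} \<alpha>"
    and "\<And>s. s \<in> {1..m} \<Longrightarrow> invertible (A s)"
    and "\<And>s. s \<in> {1..m} \<Longrightarrow> diagonalizable (A s)"
    and "R \<ge> 2"
    and "\<And>z. char_fun m \<alpha> A S T z = (\<Sum>r=1..R. \<delta> r * exp (z * cnj (\<gamma> r)))"
    and "inj_on \<gamma> {1..R}"
    and "\<And>r. r \<in> {1..R} \<Longrightarrow> \<delta> r \<noteq> 0"
    and "generic_case R Q \<gamma>"
    and "0 < \<epsilon>" and "\<epsilon> < 1/9"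
  shows "\<exists>T\<^sub>\<epsilon>::real. \<forall>z. eigenvalue_of m \<alpha> A S T z \<and> cmod z > T\<^sub>\<epsilon> \<longrightarrow>
           (\<exists>r\<in>{1..Q}. z \<in> strip Q \<gamma> \<delta> \<epsilon> r)"
proof -
  obtain B where B: "\<And>z. (\<Sum>r=1..R. \<delta> r * exp (z * cnj (\<gamma> r))) = 0 \<Longrightarrow> cmod z > B \<Longrightarrow>
      \<exists>r\<in>{1..Q}. z \<in> strip Q \<gamma> \<delta> \<epsilon> r"
    using exponential_sum_zeros_in_strips[where \<delta> = \<delta>, OF assms(9,7,8,10)] by blast
  have "(\<Sum>r=1..R. \<delta> r * exp (z * cnj (\<gamma> r))) = 0" if "eigenvalue_of m \<alpha> A S T z" for z
    using eigenvalue_of_imp_char_fun_zero[OF assms(2,3) that] assms(6) by simp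
  then show ?thesis using B by blast
qed

end
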